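(* Let $n\ge 2$, and let $(a_i)_{i\in\mathbb{Z}}$ be the first line (line $1$) of an additive frieze ("pavage additif") with $n$ lines; this sequence is periodic of period $n-1$. Choose any position $p\in\mathbb{Z}$ and insert the number $n-1$ at that position of the first line, once in each period; that is, define the sequence $(b_i)_{i\in\mathbb{Z}}$ by $$b_{mn}=n-1,\qquad b_{mn+j}=a_{p+m(n-1)+j}\quad (m\in\mathbb{Z},\ 1\le j\le n-1).$$ Then $(b_i)_{i\in\mathbb{Z}}$ is the first line of an additive frieze with $n+1$ lines. Moreover, if all entries of the original frieze with $n$ lines are nonnegative integers, then all entries of the resulting frieze with $n+1$ lines are nonnegative integers.
   Context: For $N\ge 1$, an additive frieze (pavage additif) with $N+1$ lines is an array of real numbers arranged in $N+1$ bi-infinite lines, numbered $0,1,\ldots,N$ from top to bottom, each line being shifted by half a position with respect to the previous one (like bricks in a wall), such that line $0$ and line $N$ consist only of $0$s and every elementary diamond with top $a$, left $b$, right $c$, bottom $d$ satisfies $(b+c)-(a+d)=1$. "First line" means line $1$ (the line just below the top line of zeros). Notation for the entries: line $1$ is $(a_i)_{i\in\mathbb{Z}}$; for $1\le k\le N$, the entries of line $k$ are denoted $a_{r\ldots s}$ with $r,s\in\mathbb{Z}$ and $s-r+1=k$ (with $a_{r\ldots r}=a_r$). The entry $a_{r\ldots s}$ with $r<s$ is the bottom of the diamond whose left entry is $a_{r\ldots s-1}$, whose right entry is $a_{r+1\ldots s}$, and whose top entry is $a_{r+1\ldots s-1}$ (this top entry being the entry $0$ of line $0$ when $s=r+1$).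 Thus the diamond rule reads $a_{r\ldots s}=a_{r\ldots s-1}+a_{r+1\ldots s}-a_{r+1\ldots s-1}-1$ for all $r<s$ with $s-r+1\le N$, so that the first line determines all the lower lines; a sequence is the first line of an additive frieze with $N+1$ lines exactly when the array it generates by this rule has line $N$ identically $0$. An additive frieze with $N+1$ lines is invariant under translation by $N$ positions: $a_{r+N\ldots s+N}=a_{r\ldots s}$. In particular, a frieze with $n$ lines (that is, $N=n-1$) has lines $0,\ldots,n-1$ and its first line has period $n-1$. *)

theory Defs
  imports Complex_Main
begin

text \<open>An array with lines \<open>0, 1, \<dots>\<close> is a function \<open>f\<close> of the line \<open>k\<close> and the position \<open>r\<close>:
  \<open>f k r\<close> is the entry \<open>a\<^bsub>r\<dots>r+k-1\<^esub>\<close>. As each line is shifted by half a position, the entries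
  \<open>f (k + 1) r\<close> and \<open>f (k + 1) (r + 1)\<close> are the left and right entries of the elementary diamond
  with top \<open>f k (r + 1)\<close> and bottom \<open>f (k + 2) r\<close>. A frieze with \<open>n\<close> lines consists of the lines
  \<open>k < n\<close> only; values of \<open>f\<close> at \<open>k \<ge> n\<close> are irrelevant.\<close>

definition additive_frieze :: "nat \<Rightarrow> (nat \<Rightarrow> int \<Rightarrow> real) \<Rightarrow> bool" where
  "additive_frieze n f \<longleftrightarrow>
     n \<ge> 2 \<and>
     (\<forall>r. f 0 r = 0) \<and>
     (\<forall>r. f (n - 1) r = 0) \<and>
     (\<forall>k r. k + 2 < n \<longrightarrow>
        (f (k + 1) r + f (k + 1) (r + 1)) - (f k (r + 1) + f (k + 2) r) = 1)"

definition first_line :: "(nat \<Rightarrow> int \<Rightarrow> real) \<Rightarrow> int \<Rightarrow> real" where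
  "first_line f = f 1"

definition nonneg_integer_entries :: "nat \<Rightarrow> (nat \<Rightarrow> int \<Rightarrow> real) \<Rightarrow> bool" where
  "nonneg_integer_entries n f \<longleftrightarrow> (\<forall>k<n. \<forall>r. f k r \<in> \<nat>)"

end

theory Submission
  imports Defs
begin

text \<open>The diamond rule is a second-order recurrence along the lines, and it has a closed form: line
  \<open>k\<close> consists of the sums of \<open>k\<close> consecutive entries of the first line, each diminished by the
  triangular number \<open>k (k - 1) / 2\<close> (lemma \<open>additive_frieze_iff_generated\<close>).  Being the first line
  of a frieze with \<open>n\<close> lines therefore means only that any \<open>n - 1\<close> consecutive entries have the sum
  \<open>(n - 1) (n - 2) / 2\<close>.  Periodicity follows by comparing two neighbouring such sums.

  A window of \<open>k \<le> n\<close> consecutive entries of the new line is either a window of \<open>k\<close> entries of the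
  old line, or a window of \<open>k - 1\<close> old entries together with one inserted \<open>n - 1\<close>.  In terms of the
  closed form, an entry of line \<open>k\<close> of the new frieze is in the first case an old entry of line \<open>k\<close>,
  and in the second case an old entry of line \<open>k - 1\<close> plus
  \<open>(n - 1) + (k - 1) (k - 2) / 2 - k (k - 1) / 2 = n - k\<close>
  (lemma \<open>generated_insert\<close>).  A window of length \<open>n\<close> is always of the second kind, so line \<open>n\<close>
  of the new array is line \<open>n - 1\<close> of the old one, that is, zero; and since \<open>n - k\<close> is a natural
  number, nonnegative integrality is inherited.\<close>

section \<open>The array generated by a first line\<close>

definition generated :: "(int \<Rightarrow> real) \<Rightarrow> nat \<Rightarrow> int \<Rightarrow> real" where
  "generated a k r = (\<Sum>i<k. a (r + int i)) - real k * (real k - 1) / 2"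

lemma generated_0 [simp]: "generated a 0 r = 0"
  and generated_1 [simp]: "generated a (Suc 0) r = a r"
  by (simp_all add: generated_def)

text \<open>The second difference of the window sums is \<open>0\<close>, that of \<open>k (k - 1) / 2\<close> is \<open>1\<close>.\<close>

lemma generated_Suc_Suc:
  "generated a (Suc (Suc k)) r =
     generated a (Suc k) r + generated a (Suc k) (r + 1) - generated a k (r + 1) - 1"
proof -
  have "a (r + 1 + int k) = a (r + int (Suc k))"
    by (simp add: algebra_simps)
  then show ?thesis
    unfolding generated_def by (simp add: field_simps)
qed

lemma additive_frieze_generated:
  assumes "additive_frieze n f" and "k < n"
  shows "f k r = generated (first_line f) k r"
  using assms(2)
proof (induction k arbitrary: r rule: less_induct)
  case (less k)
  consider "k = 0" | "k = 1" | l where "k = Suc (Suc l)"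
    by (metis One_nat_def not0_implies_Suc)
  then show ?case
  proof cases
    case 1
    then show ?thesis using assms(1) by (simp add: additive_frieze_def)
  next
    case 2
    then show ?thesis by (simp add: first_line_def)
  next
    case (3 l)
    then have "(f (l + 1) r + f (l + 1) (r + 1)) - (f l (r + 1) + f (l + 2) r) = 1"
      using assms(1) less.prems by (simp add: additive_frieze_def)
    then show ?thesis
      using less.IH[of l "r + 1"] less.IH[of "Suc l" r] less.IH[of "Suc l" "r + 1"] less.prems 3
      by (simp add: generated_Suc_Suc)
  qed
qed

lemma additive_frieze_iff_generated:
  assumes "n \<ge> 2"
  shows "additive_frieze n f \<longleftrightarrow>
    (\<forall>k<n. \<forall>r. f k r = generated (first_line f) k r) \<and>
    (\<forall>r. generated (first_line f) (n - 1) r = 0)"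
proof
  assume f: "additive_frieze n f"
  then have "f (n - 1) r = 0" for r
    by (simp add: additive_frieze_def)
  moreover have "n - 1 < n"
    using assms by simp
  ultimately show "(\<forall>k<n. \<forall>r. f k r = generated (first_line f) k r) \<and>
      (\<forall>r. generated (first_line f) (n - 1) r = 0)"
    using additive_frieze_generated[OF f] by metis
next
  assume "(\<forall>k<n. \<forall>r. f k r = generated (first_line f) k r) \<and>
    (\<forall>r. generated (first_line f) (n - 1) r = 0)"
  then show "additive_frieze n f"
    using assms by (auto simp: additive_frieze_def generated_Suc_Suc)
qed

lemma additive_frieze_first_line_periodic:
  assumes "additive_frieze n f"
  shows "first_line f (i + (int n - 1)) = first_line f i"
proof -
  define a where "a = first_line f"
  have n: "n \<ge> 2"
    using assms by (simp add: additive_frieze_def)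
  have "generated a (n - 1) i = 0" "generated a (n - 1) (i + 1) = 0"
    using assms additive_frieze_iff_generated[OF n, of f] by (auto simp: a_def)
  then have "(\<Sum>l<n - 1. a (i + int l)) = (\<Sum>l<n - 1. a (i + 1 + int l))"
    by (simp add: generated_def)
  also have "\<dots> = (\<Sum>l<n - 1. a (i + int (Suc l)))"
    by (simp add: algebra_simps)
  also have "\<dots> = (\<Sum>l<n - 1. a (i + int l)) + a (i + int (n - 1)) - a i"
    using sum.lessThan_Suc[of "\<lambda>l. a (i + int l)" "n - 1"]
      sum.lessThan_Suc_shift[of "\<lambda>l. a (i + int l)" "n - 1"] by simp
  finally show ?thesis
    using n by (simp add: a_def of_nat_diff)
qed

section \<open>Inserting a number periodically\<close>

lemma div_succ_int:
  fixes d x :: int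
  assumes "d > 0"
  shows "(x + 1) div d = (if d dvd x + 1 then x div d + 1 else x div d)"
proof (cases "d dvd x + 1")
  case True
  then obtain q where q: "x + 1 = d * q" ..
  then have "x div d = q - 1"
    using assms by (intro int_div_pos_eq[where r = "d - 1"]) (auto simp: algebra_simps)
  then show ?thesis
    using True q assms by simp
next
  case False
  define m where "m = (x + 1) mod d"
  have "m \<noteq> 0" "m \<ge> 0" "m < d"
    using False assms by (auto simp: m_def dvd_eq_mod_eq_0)
  moreover have "x + 1 = d * ((x + 1) div d) + m"
    by (simp add: m_def)
  ultimately have "x div d = (x + 1) div d"
    by (intro int_div_pos_eq[where r = "m - 1"]) auto
  then show ?thesis
    using False by simp
qed

text \<open>The old entry sitting at position \<open>i\<close> of the new sequence has index \<open>p + i - i div n\<close>, because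
  \<open>i div n\<close> counts the inserted entries; hence the window starting at \<open>r\<close> uses old entries from the
  index \<open>p + r - (r - 1) div n\<close> on, whether or not \<open>r\<close> itself is an inserted position.\<close>

lemma sum_insert:
  fixes a b :: "int \<Rightarrow> real" and n k :: nat and p r :: int
  assumes n: "n > 0"
    and ins: "\<And>i. int n dvd i \<Longrightarrow> b i = v"
    and old: "\<And>i. \<not> int n dvd i \<Longrightarrow> b i = a (p + i - i div int n)"
  defines "c \<equiv> \<lambda>k. nat ((r + int k - 1) div int n - (r - 1) div int n)"
  shows "c k \<le> k \<and>
    (\<Sum>i<k. b (r + int i)) =
      (\<Sum>i<k - c k. a (p + r - (r - 1) div int n + int i)) + real (c k) * v"
proof (induction k)
  case 0
  then show ?case by (simp add: c_def)
next
  case (Suc k)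
  have mono: "(r - 1) div int n \<le> (r + int k - 1) div int n"
    using n by (intro zdiv_mono1) auto
  have step: "(r + int k) div int n =
      (if int n dvd r + int k then (r + int k - 1) div int n + 1 else (r + int k - 1) div int n)"
    using div_succ_int[of "int n" "r + int k - 1"] n by simp
  show ?case
  proof (cases "int n dvd r + int k")
    case True
    then have "c (Suc k) = Suc (c k)"
      using mono step by (simp add: c_def nat_add_distrib)
    then show ?thesis
      using Suc ins[OF True] by (simp add: algebra_simps)
  next
    case False
    then have c: "c (Suc k) = c k"
      using step by (simp add: c_def)
    have "p + (r + int k) - (r + int k) div int n =
        p + r - (r - 1) div int n + int (k - c k)"
      using False step mono Suc by (simp add: c_def of_nat_diff)
    then have "b (r + int k) = a (p + r - (r - 1) div int n + int (k - c k))"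
      using old[OF False] by (simp only:)
    then show ?thesis
      using Suc by (simp add: c Suc_diff_le del: of_nat_diff)
  qed
qed

text \<open>Windows of length at most \<open>n\<close> contain at most one inserted position, and exactly one if their
  length is \<open>n\<close>.\<close>

lemma generated_insert:
  fixes a b :: "int \<Rightarrow> real" and n k :: nat and p r :: int
  assumes n: "n > 0" and k: "k \<le> n"
    and ins: "\<And>i. int n dvd i \<Longrightarrow> b i = real n - 1"
    and old: "\<And>i. \<not> int n dvd i \<Longrightarrow> b i = a (p + i - i div int n)"
  obtains s where "k < n" "generated b k r = generated a k s"
  | s where "k > 0" "generated b k r = generated a (k - 1) s + real (n - k)"
proof -
  define c where "c = nat ((r + int k - 1) div int n - (r - 1) div int n)"
  define s where "s = p + r - (r - 1) div int n"
  have ck: "c \<le> k"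
    and sum: "(\<Sum>i<k. b (r + int i)) = (\<Sum>i<k - c. a (s + int i)) + real c * (real n - 1)"
    using sum_insert[where b = b and a = a and p = p and k = k and r = r, OF n ins old]
    by (auto simp: c_def s_def)
  have "(r + int n - 1) div int n = (r - 1) div int n + 1"
    using n div_add_self2[of "int n" "r - 1"] by (simp add: algebra_simps)
  moreover have "(r + int k - 1) div int n \<le> (r + int n - 1) div int n"
    using n k by (intro zdiv_mono1) auto
  ultimately have "c \<le> 1" and cn: "k = n \<Longrightarrow> c = 1"
    by (auto simp: c_def)
  then consider "c = 0" "k < n" | "c = 1"
    using k by force
  then show thesis
  proof cases
    case 1
    then show thesis
      using sum that(1)[of s] by (simp add: generated_def)
  next
    case 2
    then have "generated b k r = generated a (k - 1) s + real (n - k)"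
      using sum ck k by (simp add: generated_def of_nat_diff field_simps)
    then show thesis
      using that(2) 2 ck by simp
  qed
qed

theorem mainTheorem2:
  fixes n :: nat and f :: "nat \<Rightarrow> int \<Rightarrow> real" and a b :: "int \<Rightarrow> real" and p :: int
  assumes "n \<ge> 2"
    and "additive_frieze n f"
    and "a = first_line f"
    and "\<And>m :: int. b (m * int n) = real n - 1"
    and "\<And>m j :: int. 1 \<le> j \<Longrightarrow> j \<le> int n - 1 \<Longrightarrow>
           b (m * int n + j) = a (p + m * (int n - 1) + j)"
  shows "(\<forall>i. a (i + (int n - 1)) = a i) \<and>
         (\<exists>g. additive_frieze (n + 1) g \<and> first_line g = b) \<and>
         (nonneg_integer_entries n f \<longrightarrow>
            (\<forall>g. additive_frieze (n + 1) g \<and> first_line g = b \<longrightarrow>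
               nonneg_integer_entries (n + 1) g))"
proof (intro conjI allI impI)
  have n: "n > 0"
    using assms(1) by simp
  have ins: "b i = real n - 1" if "int n dvd i" for i
    using assms(4)[of "i div int n"] that by simp
  have old: "b i = a (p + i - i div int n)" if "\<not> int n dvd i" for i
  proof -
    have "1 \<le> i mod int n" "i mod int n \<le> int n - 1"
      using that n pos_mod_sign[of "int n" i] pos_mod_bound[of "int n" i]
      by (auto simp: dvd_eq_mod_eq_0 simp del: pos_mod_sign pos_mod_bound)
    from assms(5)[OF this, of "i div int n"]
    have "b i = a (p + (i div int n) * (int n - 1) + i mod int n)"
      by simp
    also have "p + (i div int n) * (int n - 1) + i mod int n = p + i - i div int n"
      using div_mult_mod_eq[of i "int n"] by (simp add: algebra_simps)
    finally show ?thesis .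
  qed
  have f: "f k r = generated a k r" if "k < n" for k r
    using additive_frieze_generated[OF assms(2) that] assms(3) by simp
  have a0: "generated a (n - 1) r = 0" for r
    using assms(1-3) additive_frieze_iff_generated by simp

  show "a (i + (int n - 1)) = a i" for i
    using additive_frieze_first_line_periodic[OF assms(2)] assms(3) by simp

  have "generated b n r = 0" for r
    by (rule generated_insert[where a = a and b = b and p = p and r = r, OF n order.refl ins old])
      (auto simp: a0[unfolded One_nat_def])
  moreover have "first_line (generated b) = b"
    by (auto simp: first_line_def)
  ultimately show "\<exists>g. additive_frieze (n + 1) g \<and> first_line g = b"
    using assms(1) by (intro exI[of _ "generated b"]) (simp add: additive_frieze_iff_generated)

  fix g
  assume nonneg: "nonneg_integer_entries n f"
    and g: "additive_frieze (n + 1) g \<and> first_line g = b"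
  have aN: "generated a k r \<in> \<nat>" if "k < n" for k r
    using nonneg f that by (metis nonneg_integer_entries_def)
  have "g k r \<in> \<nat>" if "k < n + 1" for k r
  proof -
    have "k \<le> n"
      using that by simp
    have "generated b k r \<in> \<nat>"
    proof (cases rule: generated_insert[where a = a and b = b and p = p and r = r,
          OF n \<open>k \<le> n\<close> ins old, case_names _ _ without with_inserted])
      case (without s)
      then show ?thesis
        by (simp add: aN)
    next
      case (with_inserted s)
      then have "generated a (k - 1) s \<in> \<nat>"
        using \<open>k \<le> n\<close> by (intro aN) auto
      then show ?thesis
        using with_inserted by (simp only: Nats_add of_nat_in_Nats)
    qed
    then show ?thesis
      using additive_frieze_generated[of "n + 1" g k r] g that by simp
  qed
  then show "nonneg_integer_entries (n + 1) g"
    by (simp add: nonneg_integer_entries_def)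
qed

end
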